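(* Let $G$ be an unweighted graph, $n=|V(G)|$, and $k\in\{1,\dots,n-1\}$. Then there exists a dominating set of $G$ of cardinality $k$ if and only if there exists a polynomial $$p\in s(D_k[x]*I(G))$$ all of whose coefficients (of $x^j$ for $0\le j\le n-k-1$) are nonzero.
   Context: Graphs are finite and simple. A set $S\subseteq V(G)$ is a dominating set of $G$ if every vertex in $V(G)\setminus S$ is adjacent to some vertex in $S$. For a commutative ring $R$, an $R$-weighted complete graph $G$ is a complete graph on a finite vertex set $V(G)$ with a weight function $\nu_G$ from the set of all 2-element subsets of $V(G)$ to $R$. Weights in a subring are regarded as weights in the larger ring; here the ring is $\mathbb{R}[x]$. If $H,G$ are $R$-weighted complete graphs with $|V(H)|=|V(G)|$ and $f\colon V(H)\to V(G)$ is a bijection, $H*_fG$ is the $R$-weighted complete graph on $V(H)$ with $\nu_{H*_fG}(e)=\nu_H(e)\cdot\nu_G(f(e))$, where $f(\{a,b\})=\{f(a),f(b)\}$. Put $H*G=\{H*_fG : f\colon V(H)\to V(G)\text{ a bijection}\}$. For an $R$-weighted complete graph $G$, $s(G)=\sum_e\nu_G(e)$ (sum over all 2-element subsets $e$ of $V(G)$), and $s(\mathscr{G})=\{s(G):G\in\mathscr{G}\}$ for a set $\mathscr{G}$ of such graphs. For an unweighted graph $G$, $I(G)$ is the weighted complete graph on $V(G)$ with weight $1$ on edges of $G$ and $0$ on non-edges. $D_k[x]$ is the $\mathbb{R}[x]$-weighted complete graph on $\{1,\dots,n\}$ with, for $j<l$, $\nu_{D_k[x]}(\{j,l\})=x^{j-1}$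 if $j\le n-k<l$, and $0$ otherwise. *)

theory Defs
  imports
    "HOL-Library.FuncSet"
    "HOL-Library.Ramsey"
    "HOL-Computational_Algebra.Polynomial"
begin

text \<open>
  Edges are 2-element sets of vertices; \<open>nsets V 2\<close>, written \<open>[V]\<^bsup>2\<^esup>\<close>, is the set of all
  2-element subsets of \<open>V\<close>.
\<close>

definition simple_graph :: "'a set \<Rightarrow> 'a set set \<Rightarrow> bool" where
  "simple_graph V E \<longleftrightarrow> finite V \<and> E \<subseteq> [V]\<^bsup>2\<^esup>"

definition dominating_set :: "'a set \<Rightarrow> 'a set set \<Rightarrow> 'a set \<Rightarrow> bool" where
  "dominating_set V E S \<longleftrightarrow> S \<subseteq> V \<and> (\<forall>v\<in>V - S. \<exists>u\<in>S. {v, u} \<in> E)"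

record ('v, 'r) wgraph =
  verts :: "'v set"
  weight :: "'v set \<Rightarrow> 'r"

text \<open>
  A weight function is a function on the 2-element sets of vertices only; as HOL functions are
  total, it is taken to be \<open>undefined\<close> elsewhere, so that two weighted complete graphs
  are equal exactly when their vertex sets and their weights agree.
\<close>

definition weighted_complete_graph :: "('v, 'r :: comm_ring_1) wgraph \<Rightarrow> bool" where
  "weighted_complete_graph G \<longleftrightarrow> finite (verts G) \<and> weight G \<in> extensional ([verts G]\<^bsup>2\<^esup>)"

definition star_along ::
  "('v, 'r :: comm_ring_1) wgraph \<Rightarrow> ('v \<Rightarrow> 'w) \<Rightarrow> ('w, 'r) wgraph \<Rightarrow> ('v, 'r) wgraph" where
  "star_along H f G =
     \<lparr>verts = verts H, weight = (\<lambda>e\<in>[verts H]\<^bsup>2\<^esup>. weight H e * weight G (f ` e))\<rparr>"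

definition star ::
  "('v, 'r :: comm_ring_1) wgraph \<Rightarrow> ('w, 'r) wgraph \<Rightarrow> ('v, 'r) wgraph set" where
  "star H G = {star_along H f G | f. bij_betw f (verts H) (verts G)}"

definition weight_sum :: "('v, 'r :: comm_ring_1) wgraph \<Rightarrow> 'r" where
  "weight_sum G = (\<Sum>e\<in>[verts G]\<^bsup>2\<^esup>. weight G e)"

text \<open>
  The weights 0 and 1 are taken directly in whatever ring is in use, which replaces
  the passage from a subring to a larger ring.
\<close>

definition indicator_graph :: "'a set \<Rightarrow> 'a set set \<Rightarrow> ('a, 'r :: comm_ring_1) wgraph" where
  "indicator_graph V E =
     \<lparr>verts = V, weight = (\<lambda>e\<in>[V]\<^bsup>2\<^esup>. if e \<in> E then 1 else 0)\<rparr>"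

text \<open>
  An edge \<open>{j, l}\<close> with \<open>j < l\<close> has \<open>j = Min {j, l}\<close> and \<open>l = Max {j, l}\<close>; \<open>monom 1 i\<close> is the
  polynomial \<open>x ^ i\<close>. The number of vertices \<open>n\<close>, implicit in the usual notation \<open>D\<^sub>k[x]\<close>,
  is the first argument.
\<close>

definition D_graph :: "nat \<Rightarrow> nat \<Rightarrow> (nat, real poly) wgraph" where
  "D_graph n k =
     \<lparr>verts = {1..n},
      weight = (\<lambda>e\<in>[{1..n}]\<^bsup>2\<^esup>.
        let j = Min e; l = Max e
        in if j \<le> n - k \<and> n - k < l then monom 1 (j - 1) else 0)\<rparr>"

lemma weighted_complete_graph_indicator_graph:
  "simple_graph V E \<Longrightarrow> weighted_complete_graph (indicator_graph V E)"
  by (simp add: simple_graph_def weighted_complete_graph_def indicator_graph_def)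

lemma weighted_complete_graph_D_graph: "weighted_complete_graph (D_graph n k)"
  by (simp add: weighted_complete_graph_def D_graph_def)

lemma weighted_complete_graph_star:
  "weighted_complete_graph H \<Longrightarrow> K \<in> star H G \<Longrightarrow> weighted_complete_graph K"
  by (auto simp: weighted_complete_graph_def star_def star_along_def)

end

theory Submission
  imports Defs
begin

text \<open>
  A bijection \<open>f\<close> from \<open>{1..n}\<close> to \<open>V\<close> singles out the \<open>k\<close>-set \<open>S = f ` {n - k<..n}\<close> of vertices
  placed on the last \<open>k\<close> positions, and every \<open>k\<close>-set arises in this way. The weights of
  \<open>D_graph n k\<close> live only on the pairs joining an early position \<open>j\<close> to a late one, and tag such
  a pair with the monomial of degree \<open>j - 1\<close>. Multiplying by the indicator weights keeps the
  pairs that \<open>f\<close> maps to edges, so the total weight is a generating polynomial: its coefficient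
  of degree \<open>j - 1\<close> counts the neighbours of \<open>f j\<close> in \<open>S\<close> (lemma \<open>coeff_weight_sum_star_along\<close>).
  As \<open>f\<close> maps the early positions onto \<open>V - S\<close>, all these counts are nonzero
  exactly when \<open>S\<close> dominates (lemma \<open>dominating_set_iff_coeffs_nonzero\<close>).
\<close>

text \<open>
  Coefficient extraction reads off the tag: only the edges between position \<open>Suc i\<close> and a late
  position carry the monomial of degree \<open>i\<close>, each with coefficient 0 or 1, so the
  coefficient is a cardinality. In characteristic 0 no cancellation can hide a neighbour.
\<close>

lemma coeff_weight_sum_star_along:
  assumes f: "bij_betw f {1..n} V" and i: "i < n - k"
  shows "coeff (weight_sum (star_along (D_graph n k) f (indicator_graph V E))) i
       = real (card {l \<in> {n - k<..n}. {f (Suc i), f l} \<in> E})"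
proof -
  define L where "L = {l \<in> {n - k<..n}. {f (Suc i), f l} \<in> E}"
  let ?K = "star_along (D_graph n k) f (indicator_graph V E)"
  let ?edge = "\<lambda>l. {Suc i, l}"
  have coeff_weight: "coeff (weight ?K e) i = (if e \<in> ?edge ` L then 1 else 0)"
    if e: "e \<in> [{1..n}]\<^bsup>2\<^esup>" for e
  proof -
    obtain a b where ab: "e = {a, b}" "a < b" "a \<in> {1..n}" "b \<in> {1..n}"
      using e by (auto simp: nsets_2_eq) (metis insert_commute linorder_neqE_nat)
    have "f a \<in> V" "f b \<in> V" "f a \<noteq> f b"
      using f ab by (auto simp: bij_betw_def inj_on_eq_iff)
    then have image: "f ` e \<in> [V]\<^bsup>2\<^esup>"
      using ab by (auto simp: nsets_2_eq)
    have minmax: "Min e = a" "Max e = b"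
      using ab by auto
    \<comment> \<open>The alternative \<open>a = l\<close>, \<open>b = Suc i\<close> is excluded since \<open>Suc i \<le> n - k < l\<close>.\<close>
    have edge_iff: "e \<in> ?edge ` L \<longleftrightarrow> a = Suc i \<and> n - k < b \<and> f ` e \<in> E"
      using ab i by (auto simp: L_def doubleton_eq_iff image_iff)
    have "coeff (weight ?K e) i =
        coeff ((if a \<le> n - k \<and> n - k < b then monom 1 (a - 1) else 0) *
               (if f ` e \<in> E then 1 else 0)) i"
      using e image minmax
      by (simp add: star_along_def D_graph_def indicator_graph_def Let_def)
    then show ?thesis
      using ab i unfolding edge_iff by auto
  qed
  have sub: "?edge ` L \<subseteq> [{1..n}]\<^bsup>2\<^esup>"
    using i by (auto simp: L_def nsets_def card_insert_if)
  have "coeff (weight_sum ?K) i = (\<Sum>e\<in>[{1..n}]\<^bsup>2\<^esup>. coeff (weight ?K e) i)"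
    by (simp add: weight_sum_def coeff_sum star_along_def D_graph_def)
  also have "\<dots> = (\<Sum>e\<in>[{1..n}]\<^bsup>2\<^esup>. if e \<in> ?edge ` L then 1 else 0)"
    by (rule sum.cong) (simp_all only: coeff_weight)
  also have "\<dots> = real (card (?edge ` L))"
    using sub by (simp add: finite_imp_finite_nsets Int_absorb1 flip: sum.inter_restrict)
  also have "card (?edge ` L) = card L"
    by (rule card_image) (auto simp: inj_on_def doubleton_eq_iff)
  finally show ?thesis
    by (simp add: L_def)
qed

lemma dominating_set_iff_coeffs_nonzero:
  assumes f: "bij_betw f {1..n} V" and "k < n"
  shows "dominating_set V E (f ` {n - k<..n}) \<longleftrightarrow>
         (\<forall>i \<in> {0..n - k - 1}.
            coeff (weight_sum (star_along (D_graph n k) f (indicator_graph V E))) i \<noteq> 0)"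
proof -
  have nonzero_iff: "coeff (weight_sum (star_along (D_graph n k) f (indicator_graph V E))) i \<noteq> 0
      \<longleftrightarrow> (\<exists>l \<in> {n - k<..n}. {f (Suc i), f l} \<in> E)" if "i \<in> {0..n - k - 1}" for i
    using that \<open>k < n\<close> by (subst coeff_weight_sum_star_along[OF f]) auto
  have "{1..n} - {n - k<..n} = Suc ` {0..n - k - 1}"
    using \<open>k < n\<close> by (auto simp: image_Suc_atLeastAtMost)
  moreover have "V - f ` {n - k<..n} = f ` ({1..n} - {n - k<..n})"
    using f by (subst inj_on_image_set_diff[of f "{1..n}"]) (auto simp: bij_betw_def)
  ultimately have complement: "V - f ` {n - k<..n} = f ` Suc ` {0..n - k - 1}"
    by simp
  have "f ` {n - k<..n} \<subseteq> V"
    using f by (auto simp: bij_betw_def)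
  then show ?thesis
    unfolding dominating_set_def complement
    by (simp only: ball_simps bex_simps simp_thms nonzero_iff cong: ball_cong)
qed

lemma ex_bij_betw_with_final_segment:
  assumes "finite V" "S \<subseteq> V"
  obtains f where "bij_betw f {1..card V} V" "f ` {card V - card S<..card V} = S"
proof -
  define m where "m = card V - card S"
  have m: "m \<le> card V" "card V - m = card S"
    using card_mono[OF assms] by (auto simp: m_def)
  have "finite S" "card (V - S) = m"
    using assms by (auto simp: m_def card_Diff_subset finite_subset)
  then obtain g h where gh: "bij_betw g {1..m} (V - S)" "bij_betw h {m<..card V} S"
    using finite_same_card_bij[of "{1..m}" "V - S"] finite_same_card_bij[of "{m<..card V}" S]
      m \<open>finite V\<close> by auto
  define f where "f = (\<lambda>x. if x \<in> {1..m} then g x else h x)"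
  have "bij_betw f ({1..m} \<union> {m<..card V}) ((V - S) \<union> S)"
    unfolding f_def using gh by (intro bij_betw_disjoint_Un) auto
  moreover have "{1..m} \<union> {m<..card V} = {1..card V}" "(V - S) \<union> S = V"
    using m assms by auto
  moreover have "f ` {m<..card V} = S"
    using gh(2) by (auto simp: f_def bij_betw_def image_def)
  ultimately show thesis
    using that by (simp add: m_def)
qed

theorem theorem3p4:
  fixes V :: "'a set" and E :: "'a set set" and n k :: nat
  assumes "simple_graph V E"
    and "n = card V"
    and "k \<in> {1..n - 1}"
  shows "(\<exists>S. dominating_set V E S \<and> card S = k) \<longleftrightarrow>
         (\<exists>p \<in> weight_sum ` star (D_graph n k) (indicator_graph V E).
            \<forall>j \<in> {0..n - k - 1}. coeff p j \<noteq> 0)"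
proof -
  have "finite V" and "k < n"
    using assms by (auto simp: simple_graph_def)
  have star_eq: "star (D_graph n k) (indicator_graph V E) =
      {star_along (D_graph n k) f (indicator_graph V E) | f. bij_betw f {1..n} V}"
    by (simp add: star_def D_graph_def indicator_graph_def)
  have "(\<exists>S. dominating_set V E S \<and> card S = k) \<longleftrightarrow>
      (\<exists>f. bij_betw f {1..n} V \<and> dominating_set V E (f ` {n - k<..n}))"
  proof
    assume "\<exists>S. dominating_set V E S \<and> card S = k"
    then obtain S where S: "dominating_set V E S" "card S = k"
      by blast
    then have "S \<subseteq> V"
      by (simp add: dominating_set_def)
    with \<open>finite V\<close> obtain f where "bij_betw f {1..n} V" "f ` {n - k<..n} = S"
      by (metis ex_bij_betw_with_final_segment S(2) assms(2))
    with S show "\<exists>f. bij_betw f {1..n} V \<and> dominating_set V E (f ` {n - k<..n})"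
      by auto
  next
    assume "\<exists>f. bij_betw f {1..n} V \<and> dominating_set V E (f ` {n - k<..n})"
    then obtain f where f: "bij_betw f {1..n} V" "dominating_set V E (f ` {n - k<..n})"
      by blast
    then have "inj_on f {n - k<..n}"
      by (auto simp: bij_betw_def intro: inj_on_subset)
    then have "card (f ` {n - k<..n}) = k"
      using \<open>k < n\<close> by (simp add: card_image)
    with f show "\<exists>S. dominating_set V E S \<and> card S = k"
      by blast
  qed
  also have "\<dots> \<longleftrightarrow> (\<exists>f. bij_betw f {1..n} V \<and> (\<forall>j \<in> {0..n - k - 1}.
      coeff (weight_sum (star_along (D_graph n k) f (indicator_graph V E))) j \<noteq> 0))"
    using dominating_set_iff_coeffs_nonzero[OF _ \<open>k < n\<close>] by (metis (no_types, lifting))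
  also have "\<dots> \<longleftrightarrow> (\<exists>p \<in> weight_sum ` star (D_graph n k) (indicator_graph V E).
      \<forall>j \<in> {0..n - k - 1}. coeff p j \<noteq> 0)"
    unfolding star_eq by blast
  finally show ?thesis .
qed

end
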